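(* There exist arbitrarily long steady words over a $4$-letter alphabet; that is, for every $n\ge 1$ there is a steady word of length at least $n$ over the alphabet $\{\mathtt{1},\mathtt{2},\mathtt{3},\mathtt{4}\}$.
   Context: A word is a finite sequence of letters from an alphabet. A factor of a word $W$ is a contiguous subword, i.e. $W=PUS$ with $P,S$ possibly empty. A square is a nonempty word of the form $XX$. A word is square-free if it has no factor that is a square. A square-free word $W$ is steady if every word obtained from $W$ by deleting exactly one letter (at any position, including the first and last) is square-free. *)

theory Defs
  imports Main
begin

definition is_factor :: "'a list \<Rightarrow> 'a list \<Rightarrow> bool" where
  "is_factor U W \<longleftrightarrow> (\<exists>P S. W = P @ U @ S)"

definition is_square :: "'a list \<Rightarrow> bool" where
  "is_square U \<longleftrightarrow> (\<exists>X. X \<noteq> [] \<and> U = X @ X)"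

definition square_free :: "'a list \<Rightarrow> bool" where
  "square_free W \<longleftrightarrow> \<not> (\<exists>U. is_factor U W \<and> is_square U)"

definition delete_at :: "nat \<Rightarrow> 'a list \<Rightarrow> 'a list" where
  "delete_at i W = take i W @ drop (Suc i) W"

definition steady :: "'a list \<Rightarrow> bool" where
  "steady W \<longleftrightarrow> square_free W \<and> (\<forall>i < length W. square_free (delete_at i W))"

end

(*
A letter can be deleted from W so that a square XX appears exactly when W contains P a Q P Q or
P Q P a Q with X = PQ, that is, two adjacent repetitions of periods n and n + 1 (in either order)
of total length n = |X|. Words without such defects are produced by iterating a substitution of
Pansiot type: every window of five letters is replaced by a block of 15 letters that depends, up to
renaming of the letters, only on whether the fourth letter of the window equals the first. In the
image of a defect-free word, a repetition of length at least 23 has a period divisible by 15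
(a finite check), and one of period 15k and length at least 15k - 23 pulls back to a square
of the source. As 15 does not divide both n and n + 1, one half of a defect has length below 23, so
the other half nearly exhausts it and is excluded for n >= 45; smaller defects are a finite check.
*)
theory Submission
  imports Defs
begin

section \<open>Repetitions and defects\<close>

text \<open>\<open>m\<close> counts the coinciding pairs, so the repetition itself has length
  \<open>p + m\<close>. For \<open>m = 0\<close> the predicate is vacuous, even for \<open>s\<close>
  beyond the end of the word.\<close>

definition run :: "'a list \<Rightarrow> nat \<Rightarrow> nat \<Rightarrow> nat \<Rightarrow> bool" where
  "run W s p m \<longleftrightarrow> (\<forall>i<m. s + p + i < length W \<and> W ! (s + i) = W ! (s + p + i))"

text \<open>The three cases are \<open>X X\<close>, \<open>P a Q P Q\<close> and \<open>P Q P a Q\<close>, starting at position \<open>s\<close>,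
  with \<open>n\<close> the length of \<open>X\<close> and of \<open>P Q\<close>, and \<open>m\<close> the length of \<open>P\<close>.\<close>

definition defect :: "'a list \<Rightarrow> nat \<Rightarrow> nat \<Rightarrow> bool" where
  "defect W s n \<longleftrightarrow> run W s n n
     \<or> (\<exists>m\<le>n. run W s (Suc n) m \<and> run W (Suc (s + m)) n (n - m))
     \<or> (\<exists>m\<le>n. run W s n m \<and> run W (s + m) (Suc n) (n - m))"

definition good :: "'a list \<Rightarrow> bool" where
  "good W \<longleftrightarrow> (\<forall>s n. 0 < n \<longrightarrow> \<not> defect W s n)"

lemma runD:
  assumes "run W s p m" "i < m"
  shows "s + p + i < length W" "W ! (s + i) = W ! (s + p + i)"
  using assms by (auto simp: run_def)

lemma run_length:
  assumes "run W s p m" "0 < m"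
  shows "s + p + m \<le> length W"
  using runD(1)[OF assms(1), of "m - 1"] assms(2) by simp

lemma run_drop: "run (drop k W) s p m \<longleftrightarrow> run W (k + s) p m"
proof -
  have "(s + p + i < length (drop k W) \<and> drop k W ! (s + i) = drop k W ! (s + p + i)) \<longleftrightarrow>
    (k + s + p + i < length W \<and> W ! (k + s + i) = W ! (k + s + p + i))" for i
  proof (cases "k + s + p + i < length W")
    case True
    then show ?thesis by (auto simp: add.assoc)
  qed auto
  then show ?thesis by (simp add: run_def)
qed

lemma run_takeD: "run (take L W) s p m \<Longrightarrow> run W s p m"
  by (auto simp: run_def)

lemma run_takeI: "run W s p m \<Longrightarrow> s + p + m \<le> L \<Longrightarrow> run (take L W) s p m"
  by (auto simp: run_def)

lemma run_map: "inj_on f (set W) \<Longrightarrow> run (map f W) s p m \<longleftrightarrow> run W s p m"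
  by (auto simp: run_def inj_on_eq_iff)

text \<open>The second run gives the bound unless it is empty (\<open>m = n\<close>); then the first
  one does.\<close>

lemma defect_length:
  assumes "defect W s n" "0 < n"
  shows "s + 2 * n \<le> length W"
  using assms(1) unfolding defect_def
proof (elim disjE exE conjE)
  assume "run W s n n"
  from run_length[OF this assms(2)] show ?thesis by simp
next
  fix m assume "m \<le> n" "run W s (Suc n) m" "run W (Suc (s + m)) n (n - m)"
  then show ?thesis
    using assms(2) run_length[of W s "Suc n" m] run_length[of W "Suc (s + m)" n "n - m"]
    by (cases "m = n") auto
next
  fix m assume "m \<le> n" "run W s n m" "run W (s + m) (Suc n) (n - m)"
  then show ?thesis
    using assms(2) run_length[of W s n m] run_length[of W "s + m" "Suc n" "n - m"]
    by (cases "m = n") auto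
qed

lemma defect_drop: "defect (drop k W) s n \<longleftrightarrow> defect W (k + s) n"
  by (simp add: defect_def run_drop add.assoc)

lemma defect_takeD: "defect (take L W) s n \<Longrightarrow> defect W s n"
  unfolding defect_def by (meson run_takeD)

lemma defect_takeI:
  assumes "defect W s n" "s + 2 * n + 1 \<le> L"
  shows "defect (take L W) s n"
  using assms(1) unfolding defect_def
proof (elim disjE exE conjE)
  assume "run W s n n"
  then have "run (take L W) s n n" using assms(2) by (intro run_takeI) auto
  then show "run (take L W) s n n
     \<or> (\<exists>m\<le>n. run (take L W) s (Suc n) m \<and> run (take L W) (Suc (s + m)) n (n - m))
     \<or> (\<exists>m\<le>n. run (take L W) s n m \<and> run (take L W) (s + m) (Suc n) (n - m))" by blast
next
  fix m assume "m \<le> n" "run W s (Suc n) m" "run W (Suc (s + m)) n (n - m)"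
  then have "run (take L W) s (Suc n) m \<and> run (take L W) (Suc (s + m)) n (n - m)"
    using assms(2) by (intro conjI run_takeI) auto
  then show "run (take L W) s n n
     \<or> (\<exists>m\<le>n. run (take L W) s (Suc n) m \<and> run (take L W) (Suc (s + m)) n (n - m))
     \<or> (\<exists>m\<le>n. run (take L W) s n m \<and> run (take L W) (s + m) (Suc n) (n - m))"
    using \<open>m \<le> n\<close> by blast
next
  fix m assume "m \<le> n" "run W s n m" "run W (s + m) (Suc n) (n - m)"
  then have "run (take L W) s n m \<and> run (take L W) (s + m) (Suc n) (n - m)"
    using assms(2) by (intro conjI run_takeI) auto
  then show "run (take L W) s n n
     \<or> (\<exists>m\<le>n. run (take L W) s (Suc n) m \<and> run (take L W) (Suc (s + m)) n (n - m))
     \<or> (\<exists>m\<le>n. run (take L W) s n m \<and> run (take L W) (s + m) (Suc n) (n - m))"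
    using \<open>m \<le> n\<close> by blast
qed

lemma defect_map: "inj_on f (set W) \<Longrightarrow> defect (map f W) s n \<longleftrightarrow> defect W s n"
  by (simp add: defect_def run_map)

lemma good_drop: "good W \<Longrightarrow> good (drop k W)"
  by (simp add: good_def defect_drop)

lemma good_take: "good W \<Longrightarrow> good (take k W)"
  unfolding good_def by (meson defect_takeD)

lemma good_map: "inj_on f (set W) \<Longrightarrow> good (map f W) \<longleftrightarrow> good W"
  by (simp add: good_def defect_map)

lemma good_neq_Suc:
  assumes "good W" "Suc i < length W"
  shows "W ! i \<noteq> W ! Suc i"
proof
  assume "W ! i = W ! Suc i"
  then have "run W i 1 1" using assms(2) by (simp add: run_def)
  then have "defect W i 1" by (simp add: defect_def)
  then show False using assms(1) by (simp add: good_def)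
qed

text \<open>Deleting the middle of \<open>x y x\<close> leaves \<open>x x\<close>: a defect of size
  1 with P = x and Q empty.\<close>

lemma good_neq_Suc_Suc:
  assumes "good W" "i + 2 < length W"
  shows "W ! i \<noteq> W ! (i + 2)"
proof
  assume "W ! i = W ! (i + 2)"
  then have "run W i (Suc 1) 1" "run W (Suc (i + 1)) 1 (1 - 1)"
    using assms(2) by (simp_all add: run_def)
  then have "defect W i 1" unfolding defect_def by blast
  then show False using assms(1) by (simp add: good_def)
qed

section \<open>Good words are steady\<close>

lemma good_square_free:
  assumes "good W"
  shows "square_free W"
  unfolding square_free_def is_factor_def is_square_def
proof (clarsimp)
  fix P S X :: "'a list"
  assume X: "X \<noteq> []" and W: "W = P @ X @ X @ S"
  have "run W (length P) (length X) (length X)"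
    unfolding run_def W by (auto simp: nth_append)
  then have "defect W (length P) (length X)" by (simp add: defect_def)
  then show False using assms X by (simp add: good_def)
qed

lemma nth_before_delete_at: "i \<le> length W \<Longrightarrow> j < i \<Longrightarrow> delete_at i W ! j = W ! j"
  by (simp add: delete_at_def nth_append)

lemma nth_after_delete_at:
  "i < length W \<Longrightarrow> i \<le> j \<Longrightarrow> Suc j < length W \<Longrightarrow> delete_at i W ! j = W ! Suc j"
  by (simp add: delete_at_def nth_append min_def)

lemma length_delete_at: "i < length W \<Longrightarrow> length (delete_at i W) = length W - 1"
  by (simp add: delete_at_def)

text \<open>A square left after deleting letter \<open>i\<close> is pulled back to \<open>W\<close>:
  if \<open>i\<close> lies outside the square, it is a square of \<open>W\<close>; if inside the
  first or second half, the missing letter is the a of P a Q P Q or P Q P a Q.\<close>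

lemma good_steady:
  assumes "good W"
  shows "steady W"
  unfolding steady_def
proof (intro conjI allI impI)
  show "square_free W" using assms by (rule good_square_free)
next
  fix i assume i: "i < length W"
  show "square_free (delete_at i W)"
    unfolding square_free_def is_factor_def is_square_def
  proof (clarsimp)
    fix P S X :: "'a list"
    assume X: "X \<noteq> []" and D: "delete_at i W = P @ X @ X @ S"
    let ?s = "length P" and ?n = "length X"
    have len: "length W = Suc (?s + 2 * ?n + length S)"
      using length_delete_at[OF i] i unfolding D by simp
    have per: "delete_at i W ! (?s + j) = delete_at i W ! (?s + ?n + j)" if "j < ?n" for j
      using that unfolding D by (auto simp: nth_append)
    have lo: "delete_at i W ! j = W ! j" if "j < i" for j
      using that i by (simp add: nth_before_delete_at)
    have hi: "delete_at i W ! j = W ! Suc j" if "i \<le> j" "Suc j < length W" for j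
      using that i by (simp add: nth_after_delete_at)
    consider "i \<le> ?s" | "?s < i" "i < ?s + ?n" | "?s + ?n \<le> i" "i < ?s + 2 * ?n" | "?s + 2 * ?n \<le> i"
      by linarith
    then have "\<exists>t. defect W t ?n"
    proof cases
      case 1
      have "run W (Suc ?s) ?n ?n"
        unfolding run_def
      proof (intro allI impI conjI)
        fix j assume j: "j < ?n"
        show "Suc ?s + ?n + j < length W" using j len by simp
        show "W ! (Suc ?s + j) = W ! (Suc ?s + ?n + j)"
          using per[OF j] hi[of "?s + j"] hi[of "?s + ?n + j"] 1 j len by simp
      qed
      then show ?thesis by (auto simp: defect_def)
    next
      case 2
      \<comment> \<open>P is the part of the first X before the deleted letter; before it the period
        grows to \<open>Suc ?n\<close>, after it the period is still \<open>?n\<close>.\<close>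
      let ?m = "i - ?s"
      have "run W ?s (Suc ?n) ?m"
        unfolding run_def
      proof (intro allI impI conjI)
        fix j assume j: "j < ?m"
        show "?s + Suc ?n + j < length W" using j len 2 by simp
        show "W ! (?s + j) = W ! (?s + Suc ?n + j)"
          using per[of j] lo[of "?s + j"] hi[of "?s + ?n + j"] 2 j len by simp
      qed
      moreover have "run W (Suc (?s + ?m)) ?n (?n - ?m)"
        unfolding run_def
      proof (intro allI impI conjI)
        fix j assume j: "j < ?n - ?m"
        show "Suc (?s + ?m) + ?n + j < length W" using j len 2 by simp
        show "W ! (Suc (?s + ?m) + j) = W ! (Suc (?s + ?m) + ?n + j)"
          using per[of "?m + j"] hi[of "?s + ?m + j"] hi[of "?s + ?n + ?m + j"] 2 j len
          by (simp add: algebra_simps)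
      qed
      moreover have "?m \<le> ?n" using 2 by simp
      ultimately show ?thesis unfolding defect_def by blast
    next
      case 3
      let ?m = "i - ?s - ?n"
      have "run W ?s ?n ?m"
        unfolding run_def
      proof (intro allI impI conjI)
        fix j assume j: "j < ?m"
        show "?s + ?n + j < length W" using j len 3 by simp
        show "W ! (?s + j) = W ! (?s + ?n + j)"
          using per[of j] lo[of "?s + j"] lo[of "?s + ?n + j"] 3 j len by simp
      qed
      moreover have "run W (?s + ?m) (Suc ?n) (?n - ?m)"
        unfolding run_def
      proof (intro allI impI conjI)
        fix j assume j: "j < ?n - ?m"
        show "?s + ?m + Suc ?n + j < length W" using j len 3 by simp
        show "W ! (?s + ?m + j) = W ! (?s + ?m + Suc ?n + j)"
          using per[of "?m + j"] lo[of "?s + ?m + j"] hi[of "?s + ?n + ?m + j"] 3 j len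
          by (simp add: algebra_simps)
      qed
      moreover have "?m \<le> ?n" using 3 by simp
      ultimately show ?thesis unfolding defect_def by blast
    next
      case 4
      have "run W ?s ?n ?n"
        unfolding run_def
      proof (intro allI impI conjI)
        fix j assume j: "j < ?n"
        show "?s + ?n + j < length W" using j len by simp
        show "W ! (?s + j) = W ! (?s + ?n + j)"
          using per[OF j] lo[of "?s + j"] lo[of "?s + ?n + j"] 4 j len by simp
      qed
      then show ?thesis by (auto simp: defect_def)
    qed
    then show False using assms X by (auto simp: good_def)
  qed
qed

section \<open>Executable tests\<close>

fun agree :: "nat \<Rightarrow> 'a list \<Rightarrow> 'a list \<Rightarrow> bool" where
  "agree 0 A B = True"
| "agree (Suc n) (a # A) (b # B) = (a = b \<and> agree n A B)"
| "agree (Suc n) [] B = False"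
| "agree (Suc n) (a # A) [] = False"

text \<open>Agreement of \<open>A\<close> with \<open>B\<close> on \<open>n\<close> letters after
  the entry of \<open>A\<close> at some position \<open>m <= n\<close> is skipped; one pass searches
  for \<open>m\<close>.\<close>

fun near :: "nat \<Rightarrow> 'a list \<Rightarrow> 'a list \<Rightarrow> bool" where
  "near 0 A B = True"
| "near (Suc n) (a # A) (b # B) = (agree (Suc n) A (b # B) \<or> (a = b \<and> near n A B))"
| "near (Suc n) [] B = False"
| "near (Suc n) (a # A) [] = False"

definition bad :: "nat \<Rightarrow> 'a list \<Rightarrow> bool" where
  "bad n V \<longleftrightarrow> agree n V (drop n V) \<or> near n V (drop (Suc n) V) \<or> near n (drop n V) V"

lemma agree_iff: "agree n A B \<longleftrightarrow> (\<forall>i<n. i < length A \<and> i < length B \<and> A ! i = B ! i)"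
  by (induction n A B rule: agree.induct) (auto simp: All_less_Suc2)

lemma agree_commute: "agree n A B \<longleftrightarrow> agree n B A"
  by (auto simp: agree_iff)

lemma agree_drop: "agree m (drop a W) (drop (a + p) W) \<longleftrightarrow> run W a p m"
proof -
  have "(i < length (drop a W) \<and> i < length (drop (a + p) W) \<and> drop a W ! i = drop (a + p) W ! i) \<longleftrightarrow>
    (a + p + i < length W \<and> W ! (a + i) = W ! (a + p + i))" for i
    by (cases "a + p + i < length W") auto
  then show ?thesis by (simp add: agree_iff run_def)
qed

lemma near_iff: "near n A B \<longleftrightarrow> (\<exists>m\<le>n. agree m A B \<and> agree (n - m) (drop (Suc m) A) (drop m B))"
proof (induction n A B rule: near.induct)
  case (2 n a A b B)
  show ?case (is "?l = (\<exists>m\<le>Suc n. ?P m)")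
  proof -
    have "(\<exists>m\<le>Suc n. ?P m) \<longleftrightarrow> ?P 0 \<or> (\<exists>m\<le>n. ?P (Suc m))"
      by (metis Suc_le_mono not0_implies_Suc zero_le)
    also have "\<dots> \<longleftrightarrow> ?l" using 2 by auto
    finally show ?thesis by blast
  qed
next
  case (3 n B)
  have "\<not> (agree m [] B \<and> agree (Suc n - m) (drop (Suc m) []) (drop m B))" for m :: nat
    by (cases m) (auto simp: agree_iff)
  then show ?case by simp
next
  case (4 n a A)
  have "\<not> (agree m (a # A) [] \<and> agree (Suc n - m) (drop (Suc m) (a # A)) (drop m []))" for m :: nat
    by (cases m) (auto simp: agree_iff)
  then show ?case by simp
qed auto

lemma bad_drop: "bad n (drop s W) \<longleftrightarrow> defect W s n"
proof -
  have 1: "agree n (drop s W) (drop n (drop s W)) \<longleftrightarrow> run W s n n"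
    using agree_drop[of n s W n] by (simp add: add.commute)
  have 2: "agree m (drop s W) (drop (Suc n) (drop s W)) \<longleftrightarrow> run W s (Suc n) m"
    "agree (n - m) (drop (Suc m) (drop s W)) (drop m (drop (Suc n) (drop s W)))
      \<longleftrightarrow> run W (Suc (s + m)) n (n - m)" for m
    using agree_drop[of m s W "Suc n"] agree_drop[of "n - m" "Suc (s + m)" W n]
    by (simp_all add: algebra_simps)
  have 3: "agree m (drop n (drop s W)) (drop s W) \<longleftrightarrow> run W s n m"
    "agree (n - m) (drop (Suc m) (drop n (drop s W))) (drop m (drop s W))
      \<longleftrightarrow> run W (s + m) (Suc n) (n - m)" for m
    using agree_drop[of m s W n] agree_drop[of "n - m" "s + m" W "Suc n"]
    by (simp_all add: algebra_simps agree_commute)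
  show ?thesis by (simp only: bad_def near_iff defect_def 1 2 3)
qed

lemma bad_0: "bad n V \<longleftrightarrow> defect V 0 n"
  using bad_drop[of n 0 V] by simp

text \<open>The last argument of \<open>scan\<close> is kept equal to \<open>drop n V\<close>, and the two functions are first-order
  recursions: both make the evaluation by the simplifier feasible.\<close>

fun scan :: "nat \<Rightarrow> nat \<Rightarrow> 'a list \<Rightarrow> 'a list \<Rightarrow> bool" where
  "scan 0 n V A = True"
| "scan (Suc k) n V [] = True"
| "scan (Suc k) n V (a # A) =
    (\<not> agree n V (a # A) \<and> \<not> near n V A \<and> \<not> near n (a # A) V \<and> scan k (Suc n) V A)"

fun scans :: "nat \<Rightarrow> 'a list \<Rightarrow> bool" where
  "scans 0 V = True"
| "scans (Suc r) [] = True"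
| "scans (Suc r) (x # V) = (scan 44 1 (x # V) V \<and> scans r V)"

lemma scan_not_bad:
  assumes "scan k n V (drop n V)" "0 < n" "n \<le> n'" "n' < n + k"
  shows "\<not> bad n' V"
  using assms
proof (induction k arbitrary: n)
  case (Suc k)
  show ?case
  proof (cases "drop n V")
    \<comment> \<open>Here \<open>V\<close> has length at most \<open>n\<close>, whereas a defect of
      size \<open>n' >= n\<close> needs at least \<open>2 * n'\<close> letters.\<close>
    case Nil
    then show ?thesis
      using defect_length[of V 0 n'] Suc.prems by (auto simp: bad_0)
  next
    case (Cons a A)
    then have A: "A = drop (Suc n) V" by (metis drop_Suc list.sel(3) tl_drop)
    from Suc.prems(1) have *: "\<not> bad n V" "scan k (Suc n) V (drop (Suc n) V)"
      by (auto simp: bad_def Cons A)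
    show ?thesis
    proof (cases "n' = n")
      case False
      then show ?thesis using Suc.IH[OF *(2)] Suc.prems by simp
    qed (use * in simp)
  qed
qed simp

lemma scans_not_bad:
  assumes "scans R V" "r < R" "0 < n" "n < 45"
  shows "\<not> bad n (drop r V)"
  using assms
proof (induction R V arbitrary: r rule: scans.induct)
  case (2 R)
  then show ?case using defect_length[of "[]" 0 n] by (auto simp: bad_0)
next
  case (3 R x V)
  show ?case
  proof (cases r)
    case 0
    \<comment> \<open>44 sizes counted from 1 are exactly those below 45.\<close>
    have "scan 44 1 (x # V) (drop 1 (x # V))" using 3 by simp
    from scan_not_bad[OF this] 3 0 show ?thesis by simp
  next
    case (Suc r')
    then show ?thesis using 3 by simp
  qed
qed simp

section \<open>Good words up to renaming\<close>

text \<open>Up to renaming, a good word ends in \<open>1, 2, 3\<close>. Since \<open>ext k\<close> is used only for \<open>k \<le> 8\<close>,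
  defects of size at most 5 are the only ones to be excluded.\<close>

fun ext :: "nat \<Rightarrow> nat list list" where
  "ext 0 = [[1, 2, 3]]"
| "ext (Suc k) = concat (map (\<lambda>u. filter (\<lambda>v. list_all (\<lambda>n. \<not> bad n v) [1, 2, 3, 4, 5])
     (map (\<lambda>x. x # u) [1, 2, 3, 4])) (ext k))"

text \<open>Words grow to the left and suffixes of good words are good, so each step only has to
  test defects at position 0.\<close>

lemma in_ext:
  assumes "good u" "set u \<subseteq> {1, 2, 3, 4}" "length u = k + 3" "drop k u = [1, 2, 3]"
  shows "u \<in> set (ext k)"
  using assms
proof (induction k arbitrary: u)
  case (Suc k)
  from Suc.prems(3) obtain x v where u: "u = x # v" by (cases u) auto
  have "good v" using good_drop[OF Suc.prems(1), of 1] u by simp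
  then have v: "v \<in> set (ext k)" using Suc u by simp
  have "\<not> bad n u" if "0 < n" for n
    using Suc.prems(1) that by (simp add: bad_0 good_def)
  then have "list_all (\<lambda>n. \<not> bad n u) [1, 2, 3, 4, 5]" by simp
  moreover have "u \<in> set (map (\<lambda>x. x # v) [1, 2, 3, 4])" using Suc.prems(2) u by auto
  ultimately have "u \<in> set (filter (\<lambda>v. list_all (\<lambda>n. \<not> bad n v) [1, 2, 3, 4, 5])
      (map (\<lambda>x. x # v) [1, 2, 3, 4]))"
    unfolding set_filter by blast
  then show ?case using v unfolding ext.simps set_concat set_map by blast
qed simp

text \<open>Three distinct letters leave exactly one other, so the default value 4 is taken only
  once.\<close>

lemma inj_on_normalise:
  assumes xyz: "x \<in> {1, 2, 3, 4 :: nat}" "y \<in> {1, 2, 3, 4}" "z \<in> {1, 2, 3, 4}"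
    and neq: "x \<noteq> y" "y \<noteq> z" "x \<noteq> z"
  shows "inj_on (\<lambda>t. if t = x then 1 else if t = y then 2 else if t = z then 3 else 4 :: nat) {1, 2, 3, 4}"
proof (rule inj_onI)
  fix s t :: nat
  assume st: "s \<in> {1, 2, 3, 4}" "t \<in> {1, 2, 3, 4}"
    and eq: "(if s = x then 1 else if s = y then 2 else if s = z then 3 else 4 :: nat) =
      (if t = x then 1 else if t = y then 2 else if t = z then 3 else 4)"
  have "{x, y, z} \<subseteq> {1, 2, 3, 4}" using xyz by blast
  then have "card ({1, 2, 3, 4} - {x, y, z}) = 1"
    using neq by (subst card_Diff_subset) simp_all
  then obtain c where "{1, 2, 3, 4} - {x, y, z} = {c}" by (rule card_1_singletonE)
  then have "s \<noteq> x \<Longrightarrow> s \<noteq> y \<Longrightarrow> s \<noteq> z \<Longrightarrow> s = c"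
    "t \<noteq> x \<Longrightarrow> t \<noteq> y \<Longrightarrow> t \<noteq> z \<Longrightarrow> t = c"
    using st by blast+
  with eq show "s = t" by (simp split: if_split_asm)
qed

text \<open>The last three letters of a good word are pairwise distinct, hence can be renamed to 1,
  2, 3; an injective renaming preserves goodness.\<close>

lemma ext_normal_form:
  assumes "good u" "set u \<subseteq> {1, 2, 3, 4 :: nat}" "length u = k + 3"
  obtains q :: "nat \<Rightarrow> nat" where "inj_on q {1, 2, 3, 4}" "map q u \<in> set (ext k)"
proof -
  let ?x = "u ! k" and ?y = "u ! (k + 1)" and ?z = "u ! (k + 2)"
  define q :: "nat \<Rightarrow> nat" where
    "q = (\<lambda>t. if t = ?x then 1 else if t = ?y then 2 else if t = ?z then 3 else 4)"
  have neq: "?x \<noteq> ?y" "?y \<noteq> ?z" "?x \<noteq> ?z"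
    using good_neq_Suc[OF assms(1), of k] good_neq_Suc[OF assms(1), of "k + 1"]
      good_neq_Suc_Suc[OF assms(1), of k] assms(3) by simp_all
  have "?x \<in> set u" "?y \<in> set u" "?z \<in> set u"
    using assms(3) by simp_all
  then have "?x \<in> {1, 2, 3, 4}" "?y \<in> {1, 2, 3, 4}" "?z \<in> {1, 2, 3, 4}"
    using assms(2) by blast+
  with neq have inj: "inj_on q {1, 2, 3, 4}"
    unfolding q_def by (intro inj_on_normalise)
  have "drop k u = [?x, ?y, ?z]"
    using assms(3) by (intro nth_equalityI) (auto simp: less_Suc_eq numeral_3_eq_3)
  then have "drop k (map q u) = [1, 2, 3]"
    using neq by (auto simp: drop_map q_def)
  moreover have "good (map q u)"
    using good_map[OF inj_on_subset[OF inj assms(2)]] assms(1) by blast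
  moreover have "set (map q u) \<subseteq> {1, 2, 3, 4}"
    by (auto simp: q_def)
  ultimately have "map q u \<in> set (ext k)"
    using assms(3) by (intro in_ext) auto
  with inj that show ?thesis by blast
qed

section \<open>The substitution\<close>

text \<open>In a good word over four letters \<open>a\<close>, \<open>b\<close>, \<open>c\<close> are distinct, and the fourth letter of the
  alphabet is \<open>d\<close> unless \<open>d = a\<close>, in which case it is \<open>e\<close>. The two blocks were found by computer search.\<close>

definition blk :: "'a \<Rightarrow> 'a \<Rightarrow> 'a \<Rightarrow> 'a \<Rightarrow> 'a \<Rightarrow> 'a list" where
  "blk a b c d e =
    (if d = a then [a, e, b, c, a, b, e, a, c, e, b, c, a, e, c]
     else [a, d, c, a, b, d, a, c, d, b, c, a, b, d, c])"

fun img :: "'a list \<Rightarrow> 'a list" where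
  "img (a # b # c # d # e # w) = blk a b c d e @ img (b # c # d # e # w)"
| "img _ = []"

lemma length_blk [simp]: "length (blk a b c d e) = 15"
  by (simp add: blk_def)

lemma length_img: "length (img w) = 15 * (length w - 4)"
  by (induction w rule: img.induct) auto

lemma img_short: "length w < 5 \<Longrightarrow> img w = []"
  using length_img[of w] by simp

lemma drop_img: "drop (15 * i) (img w) = img (drop i w)"
proof (induction w arbitrary: i rule: img.induct)
  case (1 a b c d e w)
  show ?case
  proof (cases i)
    case (Suc j)
    then show ?thesis using 1[of j] by simp
  qed simp
qed (simp_all add: img_short)

text \<open>Each block sees four letters ahead, so \<open>k\<close> blocks depend on
  \<open>k + 4\<close> source letters.\<close>

lemma take_img: "img (take (k + 4) w) = take (15 * k) (img w)"
proof (induction w arbitrary: k rule: img.induct)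
  case (1 a b c d e w)
  show ?case
  proof (cases k)
    case (Suc j)
    then show ?thesis using 1[of j] by (simp add: numeral_eq_Suc)
  qed (simp add: img_short)
qed (simp_all add: img_short)

lemma nth_img:
  assumes "i + 4 < length w" "j < 15"
  shows "img w ! (15 * i + j) = blk (w ! i) (w ! (i + 1)) (w ! (i + 2)) (w ! (i + 3)) (w ! (i + 4)) ! j"
proof -
  have len: "15 * i + j < length (img w)" using assms by (simp add: length_img)
  have "drop i w = w ! i # w ! (i + 1) # w ! (i + 2) # w ! (i + 3) # w ! (i + 4) # drop (i + 5) w"
    using assms(1) by (simp add: Cons_nth_drop_Suc numeral_eq_Suc)
  then have "img (drop i w) ! j = blk (w ! i) (w ! (i + 1)) (w ! (i + 2)) (w ! (i + 3)) (w ! (i + 4)) ! j"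
    using assms(2) by (simp add: nth_append)
  then show ?thesis using len drop_img[of i w] by (metis less_imp_le_nat nth_drop add_leD1)
qed

lemma map_blk: "inj_on f {a, b, c, d, e} \<Longrightarrow> map f (blk a b c d e) = blk (f a) (f b) (f c) (f d) (f e)"
  by (auto simp: blk_def inj_on_def)

lemma map_img: "inj_on f (set w) \<Longrightarrow> map f (img w) = img (map f w)"
proof (induction w rule: img.induct)
  case (1 a b c d e w)
  have "inj_on f {a, b, c, d, e}" "inj_on f (set (b # c # d # e # w))"
    using 1(2) by (auto intro: inj_on_subset)
  then show ?case using 1(1) by (simp add: map_blk)
qed simp_all

lemma set_img: "set (img w) \<subseteq> set w"
proof (induction w rule: img.induct)
  case (1 a b c d e w)
  have "set (blk a b c d e) \<subseteq> {a, b, c, d, e}" by (auto simp: blk_def)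
  then show ?case using 1 by auto
qed simp_all

text \<open>The kind of block is visible: entries 0 and 3 are \<open>a\<close> and \<open>c\<close>
  in the first kind, but both \<open>a\<close> in the second. Then \<open>b\<close> and
  \<open>c\<close> can be read off.\<close>

lemma blk_prefix_eq:
  assumes "a \<noteq> c" "a' \<noteq> c'" "\<And>j. j < 5 \<Longrightarrow> blk a b c d e ! j = blk a' b' c' d' e' ! j"
  shows "a = a' \<and> b = b' \<and> c = c'"
  using assms(1,2) assms(3)[of 0] assms(3)[of 1] assms(3)[of 2] assms(3)[of 3] assms(3)[of 4]
  by (auto simp: blk_def split: if_splits)

text \<open>Entries 11 and 14 are both \<open>c\<close> in the first kind, but \<open>a\<close> and
  \<open>c\<close> in the second.\<close>

lemma blk_suffix_eq:
  assumes "a \<noteq> c" "a' \<noteq> c'"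
    "\<And>j. 10 \<le> j \<Longrightarrow> j < 15 \<Longrightarrow> blk a b c d e ! j = blk a' b' c' d' e' ! j"
  shows "a = a' \<and> b = b' \<and> c = c'"
  using assms(1,2) assms(3)[of 10] assms(3)[of 11] assms(3)[of 12] assms(3)[of 13] assms(3)[of 14]
  by (auto simp: blk_def split: if_splits)

lemma no_long_run:
  assumes "good w" "run (img w) s (15 * k) m" "0 < k" "23 \<le> m" "15 * k \<le> m + 23"
  shows False
proof -
  let ?W = "img w"
  \<comment> \<open>\<open>I\<close> is the first block whose last five letters start at or after
    \<open>s\<close>, and \<open>J\<close> the last block whose first five letters end by
    \<open>s + m\<close>.\<close>
  define I where "I = (s + 4) div 15"
  define J where "J = (s + m - 5) div 15"
  \<comment> \<open>By rounding, 15 (J - I) >= m - 23 >= 15 k - 46, and 46 < 4 * 15. This is where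
    23 comes from.\<close>
  have IJ: "I \<le> J" "k \<le> J - I + 3"
    unfolding I_def J_def using assms(4,5) by linarith+
  have J5: "15 * J + 5 \<le> s + m"
    unfolding J_def using assms(4) by linarith
  have I10: "s \<le> 15 * I + 10"
    unfolding I_def by linarith
  have "s + 15 * k + m \<le> 15 * (length w - 4)"
    using run_length[OF assms(2)] assms(4) by (simp add: length_img)
  then have Jk: "J + k + 4 < length w" using J5 by linarith
  have seen: "w ! i = w ! (i + k) \<and> w ! (i + 1) = w ! (i + k + 1) \<and> w ! (i + 2) = w ! (i + k + 2)"
    if i: "I \<le> i" "i \<le> J" for i
  proof -
    have len: "i + 4 < length w" "i + k + 4 < length w" using i Jk by simp_all
    have neq: "w ! i \<noteq> w ! (i + 2)" "w ! (i + k) \<noteq> w ! (i + k + 2)"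
      using good_neq_Suc_Suc[OF assms(1)] len by simp_all
    have eq: "blk (w ! i) (w ! (i + 1)) (w ! (i + 2)) (w ! (i + 3)) (w ! (i + 4)) ! j
        = blk (w ! (i + k)) (w ! (i + k + 1)) (w ! (i + k + 2)) (w ! (i + k + 3)) (w ! (i + k + 4)) ! j"
      if j: "j < 15" "s \<le> 15 * i + j" "15 * i + j < s + m" for j
    proof -
      have "?W ! (s + (15 * i + j - s)) = ?W ! (s + 15 * k + (15 * i + j - s))"
        using j by (intro runD(2)[OF assms(2)]) simp
      then have "?W ! (15 * i + j) = ?W ! (15 * (i + k) + j)"
        using j(2) by (simp add: algebra_simps)
      then show ?thesis using nth_img[OF len(1) j(1)] nth_img[OF len(2) j(1)] by simp
    qed
    show ?thesis
    \<comment> \<open>A block starting inside the run is read through its prefix; one starting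
      before \<open>s\<close> through its suffix.\<close>
    proof (cases "s \<le> 15 * i")
      case True
      show ?thesis
        by (rule blk_prefix_eq[OF neq], rule eq) (use True i J5 in linarith)+
    next
      case False
      show ?thesis
        by (rule blk_suffix_eq[OF neq], rule eq) (use False i I10 assms(4) in linarith)+
    qed
  qed
  \<comment> \<open>Block \<open>J\<close> also reveals the letters at \<open>J + 1\<close> and
    \<open>J + 2\<close>, so \<open>J - I + 3 >= k\<close> source letters match and form a
    square.\<close>
  have "run w I k k"
    unfolding run_def
  proof (intro allI impI conjI)
    fix j assume j: "j < k"
    show "I + k + j < length w" using j IJ Jk by linarith
    consider "I + j \<le> J" | "I + j = J + 1" | "I + j = J + 2" using j IJ by linarith
    then show "w ! (I + j) = w ! (I + k + j)"
    proof cases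
      case 1
      then show ?thesis using seen[of "I + j"] by (simp add: ac_simps)
    next
      case 2
      then have eq: "I + k + j = J + k + 1" by linarith
      show ?thesis unfolding 2 eq using seen[of J] IJ(1) by simp
    next
      case 3
      then have eq: "I + k + j = J + k + 2" by linarith
      show ?thesis unfolding 3 eq using seen[of J] IJ(1) by simp
    qed
  qed
  then have "defect w I k" by (simp add: defect_def)
  then show False using assms(1,3) by (simp add: good_def)
qed

section \<open>Synchronisation\<close>

text \<open>The code of a word records which letters reappear at distance 3 and is invariant under renaming.
  Codes of length 20, that is windows of 23 letters, determine the position modulo 15.\<close>

definition code_win :: "'a list \<Rightarrow> bool list" where
  "code_win V = take 20 (map2 (=) V (drop 3 V))"

text \<open>A window of 23 letters at offset \<open>r\<close> fits into three blocks (seven source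
  letters), and into two (six letters) if \<open>r < 8\<close>. The second list serves windows at
  the end of the word.\<close>

definition sync_table :: "(nat \<times> bool list) list" where
  "sync_table =
    concat (map (\<lambda>u. let W = img u in map (\<lambda>r. (r, code_win (drop r W))) [0..<15]) (ext 4)) @
    concat (map (\<lambda>u. let W = img u in map (\<lambda>r. (r, code_win (drop r W))) [0..<8]) (ext 3))"

definition determines :: "('a \<times> 'b) list \<Rightarrow> bool" where
  "determines T \<longleftrightarrow> list_all (\<lambda>(r, c). list_all (\<lambda>(r', c'). c = c' \<longrightarrow> r = r') T) T"

lemma determines_sync_table: "determines sync_table"
  by code_simp

lemma in_sync_table:
  "u \<in> set (ext 4) \<Longrightarrow> r < 15 \<Longrightarrow> (r, code_win (drop r (img u))) \<in> set sync_table"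
  "u \<in> set (ext 3) \<Longrightarrow> r < 8 \<Longrightarrow> (r, code_win (drop r (img u))) \<in> set sync_table"
  unfolding sync_table_def Let_def set_append set_concat set_map set_upt
  by (rule UnI1, force) (rule UnI2, force)

lemma code_win_take: "code_win (take 23 V) = code_win V"
  by (simp add: code_win_def take_map take_zip drop_take min_def)

lemma code_win_map:
  assumes "inj_on f (set V)"
  shows "code_win (map f V) = code_win V"
  unfolding code_win_def
  by (rule arg_cong[where f = "take 20"], rule nth_equalityI)
    (use assms in \<open>auto simp: inj_on_eq_iff\<close>)

lemma code_win_in_sync_table:
  assumes w: "good w" "set w \<subseteq> {1, 2, 3, 4 :: nat}" and s: "s + 23 \<le> length (img w)"
  shows "(s mod 15, code_win (drop s (img w))) \<in> set sync_table"
proof -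
  define i where "i = s div 15"
  define r where "r = s mod 15"
  define u where "u = take 7 (drop i w)"
  have sir: "s = 15 * i + r" "r < 15" by (simp_all add: i_def r_def)
  have len: "15 * i + r + 23 \<le> 15 * (length w - 4)" using s by (simp add: sir length_img)
  have u: "good u" "set u \<subseteq> {1, 2, 3, 4}"
    using w by (auto simp: u_def good_take good_drop dest!: in_set_takeD in_set_dropD)
  have lu: "length u = 7 \<or> length u = 6 \<and> r < 8"
    using len unfolding u_def by (simp add: min_def) linarith
  have "length u = (length u - 3) + 3" using lu by linarith
  from ext_normal_form[OF u this] obtain q :: "nat \<Rightarrow> nat"
    where q: "inj_on q {1, 2, 3, 4}" "map q u \<in> set (ext (length u - 3))" .
  have "drop s (img w) = drop r (img (drop i w))"
    by (simp add: sir drop_img[symmetric] add.commute)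
  then have "code_win (drop s (img w)) = code_win (take 23 (drop r (img (drop i w))))"
    by (simp add: code_win_take)
  also have "take 23 (drop r (img (drop i w))) = take 23 (drop r (img u))"
    using take_img[of 3 "drop i w"] sir(2) by (simp add: u_def drop_take min_def)
  also have "code_win \<dots> = code_win (drop r (img u))" by (rule code_win_take)
  also have "\<dots> = code_win (map q (drop r (img u)))"
  proof (rule code_win_map[symmetric])
    have "set (drop r (img u)) \<subseteq> {1, 2, 3, 4}"
      using set_drop_subset[of r "img u"] set_img[of u] u(2) by blast
    then show "inj_on q (set (drop r (img u)))" using q(1) by (rule inj_on_subset[rotated])
  qed
  also have "map q (drop r (img u)) = drop r (img (map q u))"
    using map_img[of q u] inj_on_subset[OF q(1) u(2)] by (simp add: drop_map[symmetric])
  finally have "(s mod 15, code_win (drop s (img w))) = (r, code_win (drop r (img (map q u))))"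
    by (simp add: r_def)
  moreover have "(r, code_win (drop r (img (map q u)))) \<in> set sync_table"
    using lu
  proof
    assume "length u = 7"
    then show ?thesis using q(2) sir(2) in_sync_table(1) by simp
  next
    assume "length u = 6 \<and> r < 8"
    then show ?thesis using q(2) in_sync_table(2) by simp
  qed
  ultimately show ?thesis by simp
qed

text \<open>The windows of 23 letters at \<open>s\<close> and \<open>s + p\<close> coincide, so
  their equal codes force equal residues modulo 15.\<close>

lemma run_sync:
  assumes w: "good w" "set w \<subseteq> {1, 2, 3, 4 :: nat}" and r: "run (img w) s p m" "23 \<le> m"
  shows "15 dvd p"
proof -
  let ?W = "img w"
  have len: "s + p + m \<le> length ?W" using run_length[OF r(1)] r(2) by simp
  have "take 23 (drop s ?W) = take 23 (drop (s + p) ?W)"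
    using runD(2)[OF r(1)] r(2) len by (intro nth_equalityI) auto
  then have code: "code_win (drop s ?W) = code_win (drop (s + p) ?W)"
    by (metis code_win_take)
  have "(s mod 15, code_win (drop s ?W)) \<in> set sync_table"
    "((s + p) mod 15, code_win (drop (s + p) ?W)) \<in> set sync_table"
    using len r(2) by (intro code_win_in_sync_table[OF w]; simp)+
  then have "s mod 15 = (s + p) mod 15"
    using determines_sync_table code unfolding determines_def list_all_iff by fastforce
  then show ?thesis by presburger
qed

section \<open>Defects of bounded size\<close>

text \<open>A defect of size at most 44 that starts in the first block meets at most 15 + 2 \<cdot> 44 + 1 < 105
  letters, that is seven blocks, and these depend on eleven source letters.\<close>

lemma scans_ext: "list_all (\<lambda>k. list_all (\<lambda>u. scans 15 (img u)) (ext k)) [2, 3, 4, 5, 6, 7, 8]"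
  by code_simp

lemma no_short_defect:
  assumes w: "good w" "set w \<subseteq> {1, 2, 3, 4 :: nat}" and n: "0 < n" "n < 45"
  shows "\<not> defect (img w) s n"
proof
  assume defect: "defect (img w) s n"
  define i where "i = s div 15"
  define r where "r = s mod 15"
  define u where "u = take 11 (drop i w)"
  have sir: "s = 15 * i + r" "r < 15" by (simp_all add: i_def r_def)
  have len: "15 * i + r + 2 * n \<le> 15 * (length w - 4)"
    using defect_length[OF defect n(1)] by (simp add: sir length_img)
  have u: "good u" "set u \<subseteq> {1, 2, 3, 4}"
    using w by (auto simp: u_def good_take good_drop dest!: in_set_takeD in_set_dropD)
  \<comment> \<open>Near the end of \<open>w\<close> fewer than eleven letters remain, but the
    defect needs at least one block; hence the check for all lengths from 5 to 11.\<close>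
  have lu: "5 \<le> length u" "length u \<le> 11"
    using len n(1) unfolding u_def by (simp_all add: min_def, linarith)
  have "length u = (length u - 3) + 3" using lu by linarith
  from ext_normal_form[OF u this] obtain q :: "nat \<Rightarrow> nat"
    where q: "inj_on q {1, 2, 3, 4}" "map q u \<in> set (ext (length u - 3))" .
  have "defect (img (drop i w)) r n"
    using defect by (simp add: sir drop_img[symmetric] defect_drop)
  then have "defect (take 105 (img (drop i w))) r n"
    using sir(2) n(2) by (intro defect_takeI) auto
  then have "defect (img u) r n"
    using take_img[of 7 "drop i w"] by (simp add: u_def)
  then have "defect (map q (img u)) r n"
    using inj_on_subset[OF q(1)] set_img[of u] u(2) by (subst defect_map) blast+
  then have "bad n (drop r (img (map q u)))"
    using map_img[of q u] inj_on_subset[OF q(1) u(2)] by (simp add: bad_drop)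
  moreover have "length u - 3 \<in> set [2, 3, 4, 5, 6, 7, 8]"
    using lu by auto
  then have "scans 15 (img (map q u))"
    using scans_ext q(2) unfolding list_all_iff by blast
  ultimately show False using scans_not_bad sir(2) n by blast
qed

lemma good_img:
  assumes w: "good w" "set w \<subseteq> {1, 2, 3, 4 :: nat}"
  shows "good (img w)"
  unfolding good_def
proof (intro allI impI notI)
  fix s n :: nat
  assume n: "0 < n" and defect: "defect (img w) s n"
  have n45: "45 \<le> n" using no_short_defect[OF w n] defect not_le by blast
  \<comment> \<open>Any run with at least 23 coincidences misses a full period by more than
    23.\<close>
  have long: "m + 23 < p" if "run (img w) t p m" "23 \<le> m" "0 < p" for t p m
  proof (rule ccontr)
    assume "\<not> m + 23 < p"
    moreover have "15 dvd p" using run_sync[OF w that(1,2)] .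
    then obtain k where "p = 15 * k" by blast
    ultimately show False using no_long_run[OF w(1), of t k m] that by auto
  qed
  have split: False if "run (img w) t p m" "run (img w) t' p' m'" "m + m' = n"
    "p = n \<and> p' = Suc n \<or> p = Suc n \<and> p' = n" for t t' p p' m m'
  proof (cases "23 \<le> m \<and> 23 \<le> m'")
    case True
    then have "15 dvd p" "15 dvd p'" using run_sync[OF w] that(1,2) by blast+
    then have "15 dvd n" "15 dvd Suc n" using that(4) by auto
    then show False by presburger
  next
    case False
    \<comment> \<open>Two halves below 23 would give \<open>n <= 44\<close>.\<close>
    then have "23 \<le> m \<and> m' < 23 \<or> 23 \<le> m' \<and> m < 23" using that(3) n45 by linarith
    then show False
    proof
      assume "23 \<le> m \<and> m' < 23"
      \<comment> \<open>As \<open>p <= n + 1\<close>, the bound \<open>m + 23 < p\<close> gives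
        \<open>m' = n - m > 22\<close>, a contradiction.\<close>
      then show False using long[OF that(1)] that(3,4) n by linarith
    next
      assume "23 \<le> m' \<and> m < 23"
      then show False using long[OF that(2)] that(3,4) n by linarith
    qed
  qed
  from defect show False
    unfolding defect_def
  proof (elim disjE exE conjE)
    assume "run (img w) s n n"
    from long[OF this] n45 show False by simp
  next
    fix m assume "m \<le> n" "run (img w) s (Suc n) m" "run (img w) (Suc (s + m)) n (n - m)"
    then show False using split[of s "Suc n" m "Suc (s + m)" n "n - m"] by simp
  next
    fix m assume "m \<le> n" "run (img w) s n m" "run (img w) (s + m) (Suc n) (n - m)"
    then show False using split[of s n m "s + m" "Suc n" "n - m"] by simp
  qed
qed

section \<open>Iterating the substitution\<close>

lemma good_seed: "good [1, 2, 3, 4, 1 :: nat]"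
proof -
  let ?W = "[1, 2, 3, 4, 1 :: nat]"
  have test: "list_all (\<lambda>s. list_all (\<lambda>n. \<not> bad n (drop s ?W)) [1, 2]) [0, 1, 2, 3]"
    by code_simp
  have False if d: "defect ?W s n" "0 < n" for s n
  proof -
    have "s + 2 * n \<le> 5" using defect_length[OF d] by simp
    then have "s \<in> set [0, 1, 2, 3]" "n \<in> set [1, 2]" using d(2) by auto
    then have "\<not> bad n (drop s ?W)" using test unfolding list_all_iff by blast
    then show False using d(1) by (simp add: bad_drop)
  qed
  then show ?thesis by (auto simp: good_def)
qed

text \<open>A word of length L has an image of length 15 (L - 4), which exceeds L once L >= 5; hence
  the offset 5 and a seed of five letters.\<close>

lemma long_good_words: "\<exists>W :: nat list. set W \<subseteq> {1, 2, 3, 4} \<and> n + 5 \<le> length W \<and> good W"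
proof (induction n)
  case 0
  show ?case using good_seed by (intro exI[of _ "[1, 2, 3, 4, 1]"]) simp
next
  case (Suc n)
  then obtain W :: "nat list" where W: "set W \<subseteq> {1, 2, 3, 4}" "n + 5 \<le> length W" "good W"
    by blast
  have "set (img W) \<subseteq> {1, 2, 3, 4}" using subset_trans[OF set_img W(1)] .
  moreover have "Suc n + 5 \<le> length (img W)" using W(2) by (simp add: length_img)
  ultimately show ?case using good_img[OF W(3,1)] by blast
qed

theorem mainTheorem1:
  shows "\<forall>n::nat. n \<ge> 1 \<longrightarrow>
    (\<exists>W :: nat list. set W \<subseteq> {1,2,3,4} \<and> length W \<ge> n \<and> steady W)"
proof (intro allI impI)
  fix n :: nat
  obtain W :: "nat list" where "set W \<subseteq> {1, 2, 3, 4}" "n + 5 \<le> length W" "good W"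
    using long_good_words by blast
  then show "\<exists>W :: nat list. set W \<subseteq> {1,2,3,4} \<and> length W \<ge> n \<and> steady W"
    using good_steady by (intro exI[of _ W]) auto
qed

end
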